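(* Let $\Sigma$ be a (non-random) positive semidefinite $d\times d$ matrix, let $(X_t)_{t\ge 1}$ be random vectors in $\mathbb{R}^d$ with constant conditional mean $\mathbb{E}[X_t\mid\mathcal{F}_{t-1}]=\mu$ for all $t\ge 1$, and suppose $(X_t)$ is conditionally $\Sigma$-sub-Gaussian. Let $\alpha\in(0,1)$. Then, with probability at least $1-\alpha$, simultaneously for all $t\geq 1$, $$\left\|\frac{1}{t}\sum_{i\leq t}X_i - \mu\right\| \leq 1.21\sqrt{\frac{\mathrm{Tr}(\Sigma)}{t}} + 1.682\sqrt{\frac{\|\Sigma\|\big(\log(1.65/\alpha) + 2\log(\log_2(t)+1)\big)}{t}}.$$
   Context: $\mathcal{F}_t=\sigma(X_1,\dots,X_t)$ ($\mathcal{F}_0$ trivial). $\|\cdot\|$ is the Euclidean norm for vectors and the operator norm for matrices. $(X_t)$ is conditionally $\Sigma$-sub-Gaussian if for every $t\ge1$, $\mathbb{E}[\exp\{\lambda\langle\theta,X_t-\mu\rangle-\tfrac{\lambda^2}{2}\langle\theta,\Sigma\theta\rangle\}\mid\mathcal{F}_{t-1}]\le 1$ for all $\theta\in\mathbb{R}^d$ and $\lambda\in\mathbb{R}$. *)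

theory Defs
  imports "HOL-Probability.Probability"
begin

text \<open>The sigma-algebra generated by the random vectors with indices \<open>1, ..., t\<close>, on the
  sample space of \<open>M\<close>; for \<open>t = 0\<close> it is trivial. The value of \<open>X\<close> at index \<open>0\<close> plays no role.\<close>

definition nat_filtration ::
  "'a measure \<Rightarrow> (nat \<Rightarrow> 'a \<Rightarrow> 'b::topological_space) \<Rightarrow> nat \<Rightarrow> 'a measure" where
  "nat_filtration M X t =
     sigma (space M) (\<Union>i\<in>{1..t}. {X i -` A \<inter> space M | A. A \<in> sets borel})"

text \<open>The library has conditional expectations of scalar functions only.\<close>

definition vec_cond_exp ::
  "'a measure \<Rightarrow> 'a measure \<Rightarrow> ('a \<Rightarrow> real ^ 'n) \<Rightarrow> 'a \<Rightarrow> real ^ 'n" where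
  "vec_cond_exp M F f = (\<lambda>\<omega>. \<chi> i. real_cond_exp M F (\<lambda>\<omega>. f \<omega> $ i) \<omega>)"

definition pos_semidef :: "real ^ 'n ^ 'n \<Rightarrow> bool" where
  "pos_semidef A \<longleftrightarrow> transpose A = A \<and> (\<forall>x. 0 \<le> x \<bullet> (A *v x))"

text \<open>The integrand is nonnegative and not known to be integrable in advance, so its conditional
  expectation is the \<open>ennreal\<close>-valued one: \<open>real_cond_exp\<close> sends infinite values to \<open>0\<close> and
  would make the condition vacuous there.\<close>

definition cond_sub_gaussian ::
  "'a measure \<Rightarrow> (nat \<Rightarrow> 'a \<Rightarrow> real ^ 'n) \<Rightarrow> real ^ 'n \<Rightarrow> real ^ 'n ^ 'n \<Rightarrow> bool" where
  "cond_sub_gaussian M X \<mu> \<Sigma> \<longleftrightarrow>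
     (\<forall>t\<ge>1. \<forall>\<theta>. \<forall>l::real.
        AE \<omega> in M. nn_cond_exp M (nat_filtration M X (t - 1))
          (\<lambda>\<omega>. ennreal (exp (l * (\<theta> \<bullet> (X t \<omega> - \<mu>)) - l\<^sup>2 / 2 * (\<theta> \<bullet> (\<Sigma> *v \<theta>))))) \<omega> \<le> 1)"

end

theory Submission
  imports Defs
begin

text \<open>Mixing the supermartingales \<open>exp (l * (\<theta> \<bullet> S t) - t * l\<^sup>2 / 2 * (\<theta> \<bullet> \<Sigma> \<theta>))\<close>, with
  \<open>S t = (\<Sum>i=1..t. X i - \<mu>)\<close>, over a centred Gaussian \<open>\<theta>\<close> of variance \<open>\<sigma>\<^sup>2\<close> gives, by Ville's
  inequality, a process that stays below \<open>1 / \<delta>\<close> with probability \<open>1 - \<delta>\<close>. Comparing the mixture with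
  the Gaussian shifted to a unit vector in the direction of \<open>S t\<close> (the PAC-Bayes variational bound)
  yields \<open>l * norm (S t) \<le> t * l\<^sup>2 / 2 * (\<parallel>\<Sigma>\<parallel> + \<sigma>\<^sup>2 * trace \<Sigma>) + 1 / (2 * \<sigma>\<^sup>2) + ln (1 / \<delta>)\<close> for all \<open>t\<close>
  at once. One tunes \<open>l\<close> and \<open>\<sigma>\<close> separately for each epoch \<open>2 ^ j \<le> t < 2 ^ (j + 1)\<close>, with
  \<open>\<delta> j = \<alpha> / (1.65 * (j + 1)\<^sup>2)\<close>, and takes a union bound over \<open>j\<close>. Since the optimal tuning divides
  by \<open>\<parallel>\<Sigma>\<parallel>\<close> and \<open>trace \<Sigma>\<close>, both are first enlarged by \<open>\<epsilon> > 0\<close>, and \<open>\<epsilon>\<close> tends to \<open>0\<close> at the end.\<close>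

subsection \<open>Gaussian mixtures\<close>

text \<open>\<open>lborel\<close> is the image of a product of one-dimensional Lebesgue measures
  under the coordinate map, so Fubini for finite products factors the integral. Gaussian moments
  thereby reduce to dimension one.\<close>

lemma
  fixes f :: "'a::euclidean_space \<Rightarrow> real \<Rightarrow> real"
  assumes f: "\<And>b. b \<in> Basis \<Longrightarrow> integrable lborel (f b)"
  shows integrable_lborel_prod: "integrable lborel (\<lambda>x. \<Prod>b\<in>Basis. f b (x \<bullet> b))"
    and integral_lborel_prod:
      "(\<integral>x. (\<Prod>b\<in>Basis. f b (x \<bullet> b)) \<partial>lborel) = (\<Prod>b\<in>Basis. \<integral>x. f b x \<partial>lborel)"
proof -
  interpret product_sigma_finite "\<lambda>_::'a. lborel :: real measure"
    by (rule product_sigma_finite.intro) (rule sigma_finite_lborel)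
  have [measurable]: "f b \<in> borel_measurable borel" if "b \<in> Basis" for b
    using f[OF that] by (auto dest: borel_measurable_integrable)
  have meas: "(\<lambda>x. \<Prod>b\<in>Basis. f b (x \<bullet> b)) \<in> borel_measurable (borel :: 'a measure)"
    by measurable
  have coords: "(\<lambda>x::'a \<Rightarrow> real. \<Sum>b\<in>Basis. x b *\<^sub>R b) \<in> (\<Pi>\<^sub>M b\<in>Basis. lborel) \<rightarrow>\<^sub>M borel"
    by measurable
  have eq: "(\<Prod>b\<in>Basis. f b ((\<Sum>c\<in>Basis. x c *\<^sub>R c) \<bullet> b)) = (\<Prod>b\<in>Basis. f b (x b))"
    for x :: "'a \<Rightarrow> real"
    by simp
  show "integrable lborel (\<lambda>x. \<Prod>b\<in>Basis. f b (x \<bullet> b))"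
    unfolding lborel_eq[where 'a='a] integrable_distr_eq[OF coords meas] eq
    by (intro product_integrable_prod f) simp_all
  show "(\<integral>x. (\<Prod>b\<in>Basis. f b (x \<bullet> b)) \<partial>lborel) = (\<Prod>b\<in>Basis. \<integral>x. f b x \<partial>lborel)"
    unfolding lborel_eq[where 'a='a] integral_distr[OF coords meas] eq
    by (intro product_integral_prod f) simp_all
qed

text \<open>The density of N(0, s^2 I), kept as a product over coordinates so that integrals against
  it factor.\<close>

definition gauss_density :: "real \<Rightarrow> 'a::euclidean_space \<Rightarrow> real" where
  "gauss_density s x = (\<Prod>b\<in>Basis. normal_density 0 s (x \<bullet> b))"

lemma gauss_density_nonneg [simp]: "0 \<le> gauss_density s x"
  unfolding gauss_density_def by (intro prod_nonneg) simp

lemma borel_measurable_gauss_density [measurable]: "gauss_density s \<in> borel_measurable borel"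
  unfolding gauss_density_def[abs_def] by measurable

text \<open>Complete the square coordinate by coordinate; the extra factor is the price of
  translating the Gaussian in \<open>gauss_mixture_ge\<close>.\<close>

lemma gauss_density_shift:
  fixes a z :: "'a::euclidean_space"
  assumes "s > 0"
  shows "gauss_density s (a + z) = gauss_density s z * exp (- (a \<bullet> z) / s\<^sup>2 - (norm a)\<^sup>2 / (2 * s\<^sup>2))"
proof -
  have 1: "normal_density 0 s (u + v) = normal_density 0 s v * exp (- (u * v) / s\<^sup>2 - u * u / (2 * s\<^sup>2))" for u v
    using assms by (simp add: normal_density_def exp_add[symmetric] field_simps power2_eq_square)
  have "gauss_density s (a + z) = gauss_density s z *
      (\<Prod>b\<in>Basis. exp (- ((a \<bullet> b) * (z \<bullet> b)) / s\<^sup>2 - (a \<bullet> b) * (a \<bullet> b) / (2 * s\<^sup>2)))"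
    unfolding gauss_density_def inner_add_left 1 prod.distrib ..
  also have "(\<Prod>b\<in>Basis. exp (- ((a \<bullet> b) * (z \<bullet> b)) / s\<^sup>2 - (a \<bullet> b) * (a \<bullet> b) / (2 * s\<^sup>2)))
      = exp (- (a \<bullet> z) / s\<^sup>2 - (a \<bullet> a) / (2 * s\<^sup>2))"
    unfolding euclidean_inner[of a z] euclidean_inner[of a a]
    by (simp add: exp_sum[symmetric] sum_subtractf sum_divide_distrib sum_negf)
  finally show ?thesis
    by (simp add: power2_norm_eq_inner)
qed

section \<open>Low moments of the centred Gaussian\<close>

context
  fixes s :: real
  assumes s: "s > 0"
begin

lemma
  shows integrable_gauss_density: "integrable lborel (gauss_density s :: 'a::euclidean_space \<Rightarrow> real)"
    and integral_gauss_density: "(\<integral>x. gauss_density s (x::'a) \<partial>lborel) = 1"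
  using integrable_lborel_prod[of "\<lambda>_::'a. normal_density 0 s"] integral_lborel_prod[of "\<lambda>_::'a. normal_density 0 s"] s
  by (simp_all add: gauss_density_def[abs_def])

lemma
  fixes c :: "'a::euclidean_space"
  assumes c: "c \<in> Basis"
  shows integrable_gauss_first_moment: "integrable lborel (\<lambda>x. gauss_density s x * (x \<bullet> c))"
    and integral_gauss_first_moment: "(\<integral>x. gauss_density s x * (x \<bullet> c) \<partial>lborel) = 0"
proof -
  \<comment> \<open>The factor \<open>x\<close> is attached to coordinate \<open>c\<close> alone, so
    the product of one-dimensional integrals contains a vanishing first moment.\<close>
  define f :: "'a \<Rightarrow> real \<Rightarrow> real"
    where "f b x = normal_density 0 s x * (if b = c then x else 1)" for b x
  have int: "integrable lborel (f b)" for b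
    using s integrable_normal_moment_nz_1[of s 0] by (cases "b = c") (simp_all add: f_def[abs_def])
  have int0: "(\<integral>x. f c x \<partial>lborel) = 0"
    using integral_normal_moment_nz_1[OF s, of 0] by (simp add: f_def)
  have eq: "gauss_density s x * (x \<bullet> c) = (\<Prod>b\<in>Basis. f b (x \<bullet> b))" for x
    unfolding f_def gauss_density_def prod.distrib using c by (simp add: prod.delta')
  show "integrable lborel (\<lambda>x. gauss_density s x * (x \<bullet> c))"
    unfolding eq by (intro integrable_lborel_prod int)
  show "(\<integral>x. gauss_density s x * (x \<bullet> c) \<partial>lborel) = 0"
    unfolding eq integral_lborel_prod[OF int]
    using int0 c by (meson finite_Basis prod_zero)
qed

lemma
  fixes c d :: "'a::euclidean_space"
  assumes c: "c \<in> Basis" and d: "d \<in> Basis"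
  shows integrable_gauss_second_moment:
      "integrable lborel (\<lambda>x. gauss_density s x * ((x \<bullet> c) * (x \<bullet> d)))"
    and integral_gauss_second_moment:
      "(\<integral>x. gauss_density s x * ((x \<bullet> c) * (x \<bullet> d)) \<partial>lborel) = (if c = d then s\<^sup>2 else 0)"
proof -
  \<comment> \<open>If \<open>c = d\<close>, both extra factors fall on one coordinate and give the
    variance; otherwise coordinate \<open>c\<close> carries a first moment, which is zero.\<close>
  define f :: "'a \<Rightarrow> real \<Rightarrow> real" where
    "f b x = normal_density 0 s x * ((if b = c then x else 1) * (if b = d then x else 1))" for b x
  have sq: "integrable lborel (\<lambda>x. normal_density 0 s x * (x * x))"
      "(\<integral>x. normal_density 0 s x * (x * x) \<partial>lborel) = s\<^sup>2"
    using integrable_normal_moment[OF s, of 0 2] integral_normal_moment_even[OF s, of 0 1]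
    by (simp_all add: power2_eq_square)
  have int: "integrable lborel (f b)" for b
    using s integrable_normal_moment_nz_1[of s 0] sq(1)
    by (cases "b = c"; cases "b = d") (simp_all add: f_def[abs_def])
  have eq: "gauss_density s x * ((x \<bullet> c) * (x \<bullet> d)) = (\<Prod>b\<in>Basis. f b (x \<bullet> b))" for x
    unfolding f_def gauss_density_def prod.distrib using c d by (simp add: prod.delta')
  show "integrable lborel (\<lambda>x. gauss_density s x * ((x \<bullet> c) * (x \<bullet> d)))"
    unfolding eq by (intro integrable_lborel_prod int)
  have "(\<Prod>b\<in>Basis. \<integral>x. f b x \<partial>lborel) = (if c = d then s\<^sup>2 else 0)"
  proof (cases "c = d")
    case True
    have "(\<integral>x. f b x \<partial>lborel) = (if b = c then s\<^sup>2 else 1)" for b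
      using True s sq(2) by (simp add: f_def)
    then show ?thesis
      using True c by (simp add: prod.delta')
  next
    case False
    then have "(\<integral>x. f c x \<partial>lborel) = 0"
      using integral_normal_moment_nz_1[OF s, of 0] by (simp add: f_def)
    then show ?thesis
      using False c by (auto intro: prod_zero)
  qed
  then show "(\<integral>x. gauss_density s x * ((x \<bullet> c) * (x \<bullet> d)) \<partial>lborel) = (if c = d then s\<^sup>2 else 0)"
    unfolding eq integral_lborel_prod[OF int] .
qed

lemma
  fixes a :: "'a::euclidean_space"
  shows integrable_gauss_inner: "integrable lborel (\<lambda>x. gauss_density s x * (x \<bullet> a))"
    and integral_gauss_inner: "(\<integral>x. gauss_density s x * (x \<bullet> a) \<partial>lborel) = 0"
proof -
  have eq: "gauss_density s x * (x \<bullet> a) = (\<Sum>c\<in>Basis. (a \<bullet> c) * (gauss_density s x * (x \<bullet> c)))" for x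
    by (subst euclidean_inner) (simp add: sum_distrib_left mult_ac)
  show "integrable lborel (\<lambda>x. gauss_density s x * (x \<bullet> a))"
    unfolding eq by (intro Bochner_Integration.integrable_sum integrable_mult_right integrable_gauss_first_moment)
  show "(\<integral>x. gauss_density s x * (x \<bullet> a) \<partial>lborel) = 0"
    unfolding eq by (subst Bochner_Integration.integral_sum)
      (simp_all add: integrable_gauss_first_moment integral_gauss_first_moment)
qed

text \<open>Expand \<open>x \<bullet> A x\<close> in coordinates: mixed second moments vanish, and
  the diagonal ones add up to the trace of \<open>A\<close>.\<close>

lemma
  fixes A :: "'a::euclidean_space \<Rightarrow> 'a"
  assumes A: "linear A"
  shows integrable_gauss_quadratic: "integrable lborel (\<lambda>x. gauss_density s x * (x \<bullet> A x))"
    and integral_gauss_quadratic: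
      "(\<integral>x. gauss_density s x * (x \<bullet> A x) \<partial>lborel) = s\<^sup>2 * (\<Sum>b\<in>Basis. b \<bullet> A b)"
proof -
  have quad: "x \<bullet> A x = (\<Sum>c\<in>Basis. \<Sum>d\<in>Basis. (x \<bullet> c) * (x \<bullet> d) * (c \<bullet> A d))" for x
  proof -
    have "A x = (\<Sum>d\<in>Basis. (x \<bullet> d) *\<^sub>R A d)"
      by (subst euclidean_representation[of x, symmetric])
        (simp only: linear_sum[OF A] linear_cmul[OF A] o_def)
    then show ?thesis
      by (subst euclidean_inner)
        (simp add: inner_sum_right sum_distrib_left mult_ac inner_commute)
  qed
  have eq: "gauss_density s x * (x \<bullet> A x) = (\<Sum>c\<in>Basis. \<Sum>d\<in>Basis.
      (c \<bullet> A d) * (gauss_density s x * ((x \<bullet> c) * (x \<bullet> d))))" for x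
    by (simp add: quad sum_distrib_left mult_ac)
  show "integrable lborel (\<lambda>x. gauss_density s x * (x \<bullet> A x))"
    unfolding eq by (intro Bochner_Integration.integrable_sum integrable_mult_right integrable_gauss_second_moment)
  have "(\<integral>x. gauss_density s x * (x \<bullet> A x) \<partial>lborel) = (\<Sum>c\<in>Basis. \<Sum>d\<in>Basis. (c \<bullet> A d) * (if c = d then s\<^sup>2 else 0))"
    unfolding eq
    by (simp add: Bochner_Integration.integral_sum integrable_gauss_second_moment integral_gauss_second_moment)
  also have "\<dots> = s\<^sup>2 * (\<Sum>b\<in>Basis. b \<bullet> A b)"
    by (simp add: sum_distrib_left mult_ac if_distrib cong: if_cong)
  finally show "(\<integral>x. gauss_density s x * (x \<bullet> A x) \<partial>lborel) = s\<^sup>2 * (\<Sum>b\<in>Basis. b \<bullet> A b)" .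
qed

text \<open>A PAC-Bayesian lower bound: shift the Gaussian to mean \<open>a\<close> and use Jensen's inequality in
  the form of the tangent \<open>exp x \<ge> exp m * (1 + x - m)\<close> at the mean \<open>m\<close> of the exponent.\<close>

lemma gauss_mixture_ge:
  fixes A :: "'a::euclidean_space \<Rightarrow> 'a" and a y :: 'a
  assumes A: "linear A"
  shows "ennreal (exp (a \<bullet> y - (a \<bullet> A a + s\<^sup>2 * (\<Sum>b\<in>Basis. b \<bullet> A b)) - (norm a)\<^sup>2 / (2 * s\<^sup>2)))
    \<le> (\<integral>\<^sup>+x. ennreal (gauss_density s x * exp (x \<bullet> y - x \<bullet> A x)) \<partial>lborel)"
proof -
  \<comment> \<open>\<open>h\<close> is the exponent after substituting \<open>x = a + z\<close>,
    including the logarithm of the density ratio from \<open>gauss_density_shift\<close>;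
    \<open>m\<close> is its mean for centred Gaussian \<open>z\<close>.\<close>
  define m where "m = a \<bullet> y - (a \<bullet> A a + s\<^sup>2 * (\<Sum>b\<in>Basis. b \<bullet> A b)) - (norm a)\<^sup>2 / (2 * s\<^sup>2)"
  define h where "h z = (a + z) \<bullet> y - (a + z) \<bullet> A (a + z) - (a \<bullet> z) / s\<^sup>2 - (norm a)\<^sup>2 / (2 * s\<^sup>2)" for z
  define g where "g = (gauss_density s :: 'a \<Rightarrow> real)"
  \<comment> \<open>\<open>v\<close>, completed below to \<open>w\<close>, collects the terms linear
    in \<open>z\<close>; the adjoint enters because \<open>A\<close> may be non-symmetric.\<close>
  define v where "v = y - A a - (1 / s\<^sup>2) *\<^sub>R a"
  have A_meas [measurable]: "A \<in> borel_measurable borel"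
    using A by (intro borel_measurable_continuous_onI linear_continuous_on) (simp add: linear_conv_bounded_linear)
  have adj: "a \<bullet> A z = z \<bullet> adjoint A a" for z
    by (simp add: adjoint_works[OF A] inner_commute)
  define w where "w = v - adjoint A a"
  have h_eq: "h z = m + s\<^sup>2 * (\<Sum>b\<in>Basis. b \<bullet> A b) + z \<bullet> w - z \<bullet> A z" for z
    unfolding h_def m_def w_def v_def linear_add[OF A]
    by (simp add: inner_add_left inner_add_right inner_diff_right adj[of z] inner_commute[of a z])
  have tan_eq: "g z * (exp m * (1 + h z - m)) = exp m * ((1 + s\<^sup>2 * (\<Sum>b\<in>Basis. b \<bullet> A b)) * g z
      + g z * (z \<bullet> w) - g z * (z \<bullet> A z))" for z
    unfolding h_eq by (simp add: algebra_simps)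
  have int: "integrable lborel (\<lambda>z. g z * (exp m * (1 + h z - m)))"
    unfolding tan_eq unfolding g_def
    by (intro integrable_mult_right Bochner_Integration.integrable_add Bochner_Integration.integrable_diff
        integrable_gauss_density integrable_gauss_inner integrable_gauss_quadratic A)
  have mean: "(\<integral>z. g z * (exp m * (1 + h z - m)) \<partial>lborel) = exp m"
    unfolding tan_eq unfolding g_def
    by (simp add: integrable_gauss_density integral_gauss_density integrable_gauss_inner integral_gauss_inner
        integrable_gauss_quadratic[OF A] integral_gauss_quadratic[OF A])
  have tangent: "g z * (exp m * (1 + h z - m)) \<le> g z * exp (h z)" for z
  proof -
    have "exp m * (1 + (h z - m)) \<le> exp m * exp (h z - m)"
      by (intro mult_left_mono exp_ge_add_one_self) simp
    also have "\<dots> = exp (h z)"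
      by (simp flip: exp_add)
    finally show ?thesis
      by (intro mult_left_mono) (auto simp: g_def algebra_simps)
  qed
  have h_meas [measurable]: "h \<in> borel_measurable borel"
    unfolding h_def[abs_def] by measurable
  have g_meas [measurable]: "g \<in> borel_measurable borel"
    unfolding g_def by measurable
  have "ennreal (exp m) \<le> (\<integral>\<^sup>+z. ennreal (g z * exp (h z)) \<partial>lborel)"
  \<comment> \<open>An infinite integral makes the bound trivial; a finite one makes the integrand
    integrable, so the tangent inequality can be integrated.\<close>
  proof (cases "(\<integral>\<^sup>+z. ennreal (g z * exp (h z)) \<partial>lborel) = \<infinity>")
    case False
    then have int': "integrable lborel (\<lambda>z. g z * exp (h z))"
      by (intro integrableI_nonneg) (auto simp: g_def top.not_eq_extremum)
    have "exp m \<le> (\<integral>z. g z * exp (h z) \<partial>lborel)"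
      using integral_mono[OF int int' tangent] unfolding mean .
    then show ?thesis
      by (subst nn_integral_eq_integral[OF int']) (auto simp: g_def ennreal_leI)
  qed simp
  also have "\<dots> = (\<integral>\<^sup>+z. ennreal (gauss_density s (a + z) * exp ((a + z) \<bullet> y - (a + z) \<bullet> A (a + z))) \<partial>lborel)"
    unfolding gauss_density_shift[OF s] h_def g_def mult.assoc exp_add[symmetric]
    by (simp add: algebra_simps)
  \<comment> \<open>Translation invariance of Lebesgue measure turns \<open>a + z\<close> back into
    \<open>x\<close>.\<close>
  also have "\<dots> = (\<integral>\<^sup>+x. ennreal (gauss_density s x * exp (x \<bullet> y - x \<bullet> A x)) \<partial>distr lborel borel ((+) a))"
    by (subst nn_integral_distr) simp_all
  also have "\<dots> = (\<integral>\<^sup>+x. ennreal (gauss_density s x * exp (x \<bullet> y - x \<bullet> A x)) \<partial>lborel)"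
    by (simp add: lborel_distr_plus)
  finally show ?thesis
    unfolding m_def .
qed

end

subsection \<open>Ville's inequality and the mixture supermartingale\<close>

text \<open>Optional stopping at the first time \<open>V\<close> reaches \<open>c\<close>, unrolled
  as an induction over time. The supermartingale property is expressed by integrals over events of
  \<open>F t\<close>.\<close>

lemma ville_inequality:
  fixes V :: "nat \<Rightarrow> 'a \<Rightarrow> ennreal" and c :: ennreal
  assumes sub: "\<And>t. subalgebra M (F t)"
    and mono: "\<And>t. sets (F t) \<subseteq> sets (F (Suc t))"
    and V: "\<And>t. V t \<in> borel_measurable (F t)"
    and super: "\<And>t A. A \<in> sets (F t) \<Longrightarrow>
      (\<integral>\<^sup>+\<omega>. V (Suc t) \<omega> * indicator A \<omega> \<partial>M) \<le> (\<integral>\<^sup>+\<omega>. V t \<omega> * indicator A \<omega> \<partial>M)"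
  shows "c * emeasure M {\<omega> \<in> space M. \<exists>t. c \<le> V t \<omega>} \<le> (\<integral>\<^sup>+\<omega>. V 0 \<omega> \<partial>M)"
proof -
  have V_M [measurable]: "V t \<in> borel_measurable M" for t
    using V[of t] sub[of t] measurable_from_subalg by blast
  define H where "H n = {\<omega> \<in> space M. \<exists>t\<le>n. c \<le> V t \<omega>}" for n
  define B where "B n = {\<omega> \<in> space M. \<forall>t\<le>n. V t \<omega> < c}" for n
  have H_sets [measurable]: "H n \<in> sets M" for n
    unfolding H_def by measurable
  have space_F: "space (F n) = space M" for n
    using sub[of n] by (simp add: subalgebra_def)
  have B_F: "B n \<in> sets (F n)" for n
  proof -
    have "sets (F t) \<subseteq> sets (F n)" if "t \<le> n" for t
      using that mono by (rule lift_Suc_mono_le[rotated])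
    then have "{\<omega> \<in> space M. V t \<omega> < c} \<in> sets (F n)" if "t \<le> n" for t
      using that borel_measurable_less[OF V[of t], of "\<lambda>_. c"] by (auto simp: space_F)
    then have "(\<Inter>t\<in>{..n}. {\<omega> \<in> space M. V t \<omega> < c}) \<in> sets (F n)"
      by (intro sets.finite_INT) auto
    also have "(\<Inter>t\<in>{..n}. {\<omega> \<in> space M. V t \<omega> < c}) = B n"
      by (auto simp: B_def)
    finally show ?thesis .
  qed
  have B_sets [measurable]: "B n \<in> sets M" for n
    using B_F[of n] sub[of n] by (auto simp: subalgebra_def)
  \<comment> \<open>The invariant: paths that have reached the level are charged \<open>c\<close>,
    all others their current value.\<close>
  have main: "c * emeasure M (H n) + (\<integral>\<^sup>+\<omega>. V n \<omega> * indicator (B n) \<omega> \<partial>M) \<le> (\<integral>\<^sup>+\<omega>. V 0 \<omega> \<partial>M)" for n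
  proof (induction n)
    case 0
    have "c * emeasure M (H 0) + (\<integral>\<^sup>+\<omega>. V 0 \<omega> * indicator (B 0) \<omega> \<partial>M)
        = (\<integral>\<^sup>+\<omega>. c * indicator (H 0) \<omega> + V 0 \<omega> * indicator (B 0) \<omega> \<partial>M)"
      by (simp add: nn_integral_add nn_integral_cmult_indicator)
    also have "\<dots> \<le> (\<integral>\<^sup>+\<omega>. V 0 \<omega> \<partial>M)"
      by (intro nn_integral_mono) (auto simp: H_def B_def indicator_def)
    finally show ?case .
  next
    case (Suc n)
    \<comment> \<open>The paths that first reach the level at time \<open>Suc n\<close>, where
      \<open>c\<close> is at most \<open>V (Suc n)\<close>. Together with \<open>B (Suc n)\<close>
      they partition \<open>B n\<close>.\<close>
    let ?D = "H (Suc n) - H n"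
    have "H n \<subseteq> H (Suc n)"
      by (auto simp: H_def intro: le_SucI)
    then have "emeasure M (H (Suc n)) = emeasure M (H n) + emeasure M ?D"
      using plus_emeasure[of "H n" M ?D] by (simp add: Un_absorb1)
    then have "c * emeasure M (H (Suc n)) + (\<integral>\<^sup>+\<omega>. V (Suc n) \<omega> * indicator (B (Suc n)) \<omega> \<partial>M)
        = c * emeasure M (H n) + (\<integral>\<^sup>+\<omega>. c * indicator ?D \<omega> + V (Suc n) \<omega> * indicator (B (Suc n)) \<omega> \<partial>M)"
      by (simp add: nn_integral_add nn_integral_cmult_indicator distrib_left add.assoc)
    also have "\<dots> \<le> c * emeasure M (H n) + (\<integral>\<^sup>+\<omega>. V (Suc n) \<omega> * indicator (B n) \<omega> \<partial>M)"
    proof (intro add_left_mono nn_integral_mono)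
      fix \<omega>
      show "c * indicator ?D \<omega> + V (Suc n) \<omega> * indicator (B (Suc n)) \<omega> \<le> V (Suc n) \<omega> * indicator (B n) \<omega>"
        by (auto simp: H_def B_def indicator_def le_Suc_eq not_less)
    qed
    also have "\<dots> \<le> c * emeasure M (H n) + (\<integral>\<^sup>+\<omega>. V n \<omega> * indicator (B n) \<omega> \<partial>M)"
      by (intro add_left_mono super B_F)
    finally show ?case
      using Suc.IH by (rule order_trans)
  qed
  \<comment> \<open>Drop the integral and let \<open>n\<close> grow: the events \<open>H n\<close>
    increase to the event that the level is ever reached.\<close>
  have "(SUP n. c * emeasure M (H n)) \<le> (\<integral>\<^sup>+\<omega>. V 0 \<omega> \<partial>M)"
    using main by (intro SUP_least) (metis add.right_neutral add_left_mono order_trans zero_le)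
  moreover have "(SUP n. c * emeasure M (H n)) = c * emeasure M (\<Union>n. H n)"
    by (subst SUP_mult_left_ennreal[symmetric], subst SUP_emeasure_incseq)
      (auto simp: incseq_def H_def dest: order_trans)
  moreover have "(\<Union>n. H n) = {\<omega> \<in> space M. \<exists>t. c \<le> V t \<omega>}"
    by (auto simp: H_def)
  ultimately show ?thesis
    by simp
qed

section \<open>The natural filtration\<close>

lemma space_nat_filtration [simp]: "space (nat_filtration M X t) = space M"
  unfolding nat_filtration_def by (intro space_measure_of) auto

lemma sets_nat_filtration:
  "sets (nat_filtration M X t) = sigma_sets (space M)
     (\<Union>i\<in>{1..t}. {X i -` A \<inter> space M | A. A \<in> sets borel})"
  unfolding nat_filtration_def by (intro sets_measure_of) auto

lemma sets_nat_filtration_mono: "s \<le> t \<Longrightarrow> sets (nat_filtration M X s) \<subseteq> sets (nat_filtration M X t)"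
  unfolding sets_nat_filtration by (intro sigma_sets_mono') fastforce

lemma measurable_nat_filtration:
  fixes X :: "nat \<Rightarrow> 'a \<Rightarrow> 'b::topological_space"
  assumes "1 \<le> i" "i \<le> t"
  shows "X i \<in> borel_measurable (nat_filtration M X t)"
proof (rule measurableI)
  fix A :: "'b set" assume "A \<in> sets borel"
  then have "X i -` A \<inter> space M \<in> (\<Union>i\<in>{1..t}. {X i -` A \<inter> space M | A. A \<in> sets borel})"
    using assms by (intro UN_I[of i]) auto
  then show "X i -` A \<inter> space (nat_filtration M X t) \<in> sets (nat_filtration M X t)"
    unfolding sets_nat_filtration space_nat_filtration by (rule sigma_sets.Basic)
qed simp

lemma subalgebra_nat_filtration:
  assumes "\<And>t. t \<ge> 1 \<Longrightarrow> X t \<in> borel_measurable M"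
  shows "subalgebra M (nat_filtration M X t)"
  unfolding subalgebra_def sets_nat_filtration
  using assms by (auto intro!: sets.sigma_sets_subset measurable_sets)

section \<open>The mixture supermartingale of a sub-Gaussian process\<close>

locale sub_gaussian_process = prob_space M for M :: "'a measure" +
  fixes X :: "nat \<Rightarrow> 'a \<Rightarrow> real ^ 'n" and \<mu> :: "real ^ 'n" and \<Sigma> :: "real ^ 'n ^ 'n"
  assumes measurable_X: "\<And>t. t \<ge> 1 \<Longrightarrow> X t \<in> borel_measurable M"
    and sub_gaussian: "cond_sub_gaussian M X \<mu> \<Sigma>"
begin

abbreviation F :: "nat \<Rightarrow> 'a measure" where "F \<equiv> nat_filtration M X"

definition S :: "nat \<Rightarrow> 'a \<Rightarrow> real ^ 'n" where
  "S t \<omega> = (\<Sum>i=1..t. X i \<omega> - \<mu>)"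

lemma measurable_S_F: "S t \<in> borel_measurable (F t)"
  unfolding S_def[abs_def] by (intro borel_measurable_sum borel_measurable_diff measurable_nat_filtration) auto

lemma subalgebra_F: "subalgebra M (F t)"
  using measurable_X by (rule subalgebra_nat_filtration)

lemma measurable_S [measurable]: "S t \<in> borel_measurable M"
  using subalgebra_F measurable_S_F by (rule measurable_from_subalg)

text \<open>Since \<open>f\<close> is known at time \<open>t\<close>, it comes out of the
  conditional expectation given \<open>F t\<close>, and what remains is at most 1 almost
  everywhere.\<close>

lemma sub_gaussian_step:
  assumes f: "f \<in> borel_measurable (F t)"
  shows "(\<integral>\<^sup>+\<omega>. f \<omega> * ennreal (exp (l * (\<theta> \<bullet> (X (Suc t) \<omega> - \<mu>)) - l\<^sup>2 / 2 * (\<theta> \<bullet> (\<Sigma> *v \<theta>)))) \<partial>M)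
    \<le> (\<integral>\<^sup>+\<omega>. f \<omega> \<partial>M)"
proof -
  let ?D = "\<lambda>\<omega>. ennreal (exp (l * (\<theta> \<bullet> (X (Suc t) \<omega> - \<mu>)) - l\<^sup>2 / 2 * (\<theta> \<bullet> (\<Sigma> *v \<theta>))))"
  interpret finite_measure_subalgebra M "F t"
    by unfold_locales (rule subalgebra_F)
  have [measurable]: "X (Suc t) \<in> borel_measurable M"
    by (rule measurable_X) simp
  have "(\<integral>\<^sup>+\<omega>. f \<omega> * ?D \<omega> \<partial>M) = (\<integral>\<^sup>+\<omega>. f \<omega> * nn_cond_exp M (F t) ?D \<omega> \<partial>M)"
    by (rule nn_cond_exp_intg[symmetric, OF f]) measurable
  also have "\<dots> \<le> (\<integral>\<^sup>+\<omega>. f \<omega> \<partial>M)"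
  proof (intro nn_integral_mono_AE)
    \<comment> \<open>At time \<open>Suc t\<close> the definition conditions on
      \<open>F (Suc t - 1)\<close>, which is \<open>F t\<close>.\<close>
    have "AE \<omega> in M. nn_cond_exp M (F (Suc t - 1)) ?D \<omega> \<le> 1"
      using sub_gaussian unfolding cond_sub_gaussian_def by (metis le_add1 plus_1_eq_Suc)
    then show "AE \<omega> in M. f \<omega> * nn_cond_exp M (F t) ?D \<omega> \<le> f \<omega>"
      by eventually_elim (use mult_left_mono in fastforce)
  qed
  finally show ?thesis .
qed

text \<open>One fixed tuning for all times: Ville's inequality keeps the mixture below
  \<open>1 / \<delta>\<close>, and \<open>gauss_mixture_ge\<close>, shifted in the direction of
  \<open>S t\<close>, turns this into a norm bound. \<open>v\<close> and \<open>\<tau>\<close> are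
  only upper bounds, so that positive values can stand in for a vanishing norm or trace.\<close>

lemma uniform_sphere:
  fixes l \<sigma> \<delta> \<tau> v :: real
  assumes l: "l > 0" and \<sigma>: "\<sigma> > 0" and \<delta>: "\<delta> > 0" and v: "0 \<le> v"
    and quad: "\<And>x. norm x \<le> 1 \<Longrightarrow> x \<bullet> (\<Sigma> *v x) \<le> v" and tr: "trace \<Sigma> \<le> \<tau>"
  shows "prob {\<omega> \<in> space M. \<exists>t. norm (S t \<omega>) > l * real t / 2 * (v + \<sigma>\<^sup>2 * \<tau>) + (1 / (2 * \<sigma>\<^sup>2) + ln (1 / \<delta>)) / l}
    \<le> \<delta>"
proof -
  \<comment> \<open>With this factor \<open>\<theta> \<bullet> A t \<theta>\<close> is the
    sub-Gaussian compensator accumulated over \<open>t\<close> steps. \<open>W\<close> is then the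
    supermartingale at \<open>\<theta>\<close> weighted by the Gaussian density, and
    \<open>V\<close> is the mixture.\<close>
  define A where "A t = (\<lambda>x. (real t * l\<^sup>2 / 2) *\<^sub>R (\<Sigma> *v x))" for t
  define W where "W t \<omega> \<theta> = ennreal (gauss_density \<sigma> \<theta> * exp (\<theta> \<bullet> (l *\<^sub>R S t \<omega>) - \<theta> \<bullet> A t \<theta>))" for t \<omega> \<theta>
  define V where "V t \<omega> = (\<integral>\<^sup>+\<theta>. W t \<omega> \<theta> \<partial>lborel)" for t \<omega>
  have A_lin: "linear (A t)" for t
    unfolding A_def by (intro linear_compose_scale_right matrix_vector_mul_linear)
  have A_meas [measurable]: "A t \<in> borel_measurable borel" for t
    using A_lin[of t] by (intro borel_measurable_continuous_onI linear_continuous_on)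
      (simp add: linear_conv_bounded_linear)
  have W_F: "case_prod (W t) \<in> borel_measurable (F t \<Otimes>\<^sub>M lborel)" for t
  proof -
    note measurable_S_F[of t, measurable]
    show ?thesis
      unfolding W_def[abs_def] by measurable
  qed
  have W_M [measurable]: "case_prod (W t) \<in> borel_measurable (M \<Otimes>\<^sub>M lborel)" for t
    unfolding W_def[abs_def] by measurable
  have V_F: "V t \<in> borel_measurable (F t)" for t
    unfolding V_def[abs_def] using W_F[of t] by (rule lborel.borel_measurable_nn_integral)
  have super: "(\<integral>\<^sup>+\<omega>. V (Suc t) \<omega> * indicator B \<omega> \<partial>M) \<le> (\<integral>\<^sup>+\<omega>. V t \<omega> * indicator B \<omega> \<partial>M)"
    if B: "B \<in> sets (F t)" for t B
  proof -
    interpret pair_sigma_finite M lborel ..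
    have B_M [measurable]: "B \<in> sets M"
      using B subalgebra_F[of t] by (auto simp: subalgebra_def)
    \<comment> \<open>Tonelli moves the integral over \<open>M\<close> inside, where the one-step
      inequality applies for each fixed \<open>\<theta>\<close>.\<close>
    have swap: "(\<integral>\<^sup>+\<omega>. V k \<omega> * indicator B \<omega> \<partial>M) = (\<integral>\<^sup>+\<theta>. (\<integral>\<^sup>+\<omega>. W k \<omega> \<theta> * indicator B \<omega> \<partial>M) \<partial>lborel)" for k
    proof -
      have "W k \<omega> \<in> borel_measurable lborel" for \<omega>
        unfolding W_def[abs_def] by measurable
      then have "(\<integral>\<^sup>+\<omega>. V k \<omega> * indicator B \<omega> \<partial>M) = (\<integral>\<^sup>+\<omega>. (\<integral>\<^sup>+\<theta>. W k \<omega> \<theta> * indicator B \<omega> \<partial>lborel) \<partial>M)"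
        unfolding V_def by (simp add: nn_integral_multc)
      also have "\<dots> = (\<integral>\<^sup>+\<theta>. (\<integral>\<^sup>+\<omega>. W k \<omega> \<theta> * indicator B \<omega> \<partial>M) \<partial>lborel)"
        by (rule Fubini'[symmetric]) measurable
      finally show ?thesis .
    qed
    have step: "W (Suc t) \<omega> \<theta> = W t \<omega> \<theta> *
        ennreal (exp (l * (\<theta> \<bullet> (X (Suc t) \<omega> - \<mu>)) - l\<^sup>2 / 2 * (\<theta> \<bullet> (\<Sigma> *v \<theta>))))" for \<omega> \<theta>
    proof -
      have "\<theta> \<bullet> (l *\<^sub>R S (Suc t) \<omega>) - \<theta> \<bullet> A (Suc t) \<theta> = (\<theta> \<bullet> (l *\<^sub>R S t \<omega>) - \<theta> \<bullet> A t \<theta>)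
          + (l * (\<theta> \<bullet> (X (Suc t) \<omega> - \<mu>)) - l\<^sup>2 / 2 * (\<theta> \<bullet> (\<Sigma> *v \<theta>)))"
        by (simp add: A_def S_def algebra_simps add_divide_distrib)
      then show ?thesis
        unfolding W_def by (simp only: exp_add mult.assoc) (simp add: ennreal_mult mult.assoc)
    qed
    have "(\<integral>\<^sup>+\<omega>. W (Suc t) \<omega> \<theta> * indicator B \<omega> \<partial>M) \<le> (\<integral>\<^sup>+\<omega>. W t \<omega> \<theta> * indicator B \<omega> \<partial>M)" for \<theta>
    proof -
      note measurable_S_F[of t, measurable] B[measurable]
      have "(\<lambda>\<omega>. W t \<omega> \<theta> * indicator B \<omega>) \<in> borel_measurable (F t)"
        unfolding W_def by measurable
      from sub_gaussian_step[OF this, of l \<theta>] show ?thesis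
        unfolding step by (simp add: mult_ac)
    qed
    then show ?thesis
      unfolding swap by (rule nn_integral_mono)
  qed
  have V0: "V 0 \<omega> = 1" for \<omega>
    using integrable_gauss_density[OF \<sigma>, where 'a="real ^ 'n"] integral_gauss_density[OF \<sigma>, where 'a="real ^ 'n"]
    by (simp add: V_def W_def S_def A_def nn_integral_eq_integral)
  have "ennreal (1 / \<delta>) * emeasure M {\<omega> \<in> space M. \<exists>t. ennreal (1 / \<delta>) \<le> V t \<omega>} \<le> (\<integral>\<^sup>+\<omega>. V 0 \<omega> \<partial>M)"
    by (intro ville_inequality[where F=F] subalgebra_F sets_nat_filtration_mono V_F super) simp_all
  then have "ennreal (1 / \<delta> * prob {\<omega> \<in> space M. \<exists>t. ennreal (1 / \<delta>) \<le> V t \<omega>}) \<le> 1"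
    using \<delta> by (subst ennreal_mult) (simp_all add: V0 emeasure_eq_measure prob_space)
  then have "prob {\<omega> \<in> space M. \<exists>t. ennreal (1 / \<delta>) \<le> V t \<omega>} \<le> \<delta>"
    using \<delta> by (simp only: ennreal_le_1) (simp add: field_simps)
  moreover have "prob {\<omega> \<in> space M. \<exists>t. norm (S t \<omega>) > l * real t / 2 * (v + \<sigma>\<^sup>2 * \<tau>) + (1 / (2 * \<sigma>\<^sup>2) + ln (1 / \<delta>)) / l}
      \<le> prob {\<omega> \<in> space M. \<exists>t. ennreal (1 / \<delta>) \<le> V t \<omega>}"
  proof (intro finite_measure_mono)
    have [measurable]: "V t \<in> borel_measurable M" for t
      using subalgebra_F V_F by (rule measurable_from_subalg)
    show "{\<omega> \<in> space M. \<exists>t. ennreal (1 / \<delta>) \<le> V t \<omega>} \<in> events"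
      by measurable
    \<comment> \<open>A large norm at time \<open>t\<close> forces the mixture up to
      \<open>1 / \<delta>\<close>, so the bad event lies inside Ville's event.\<close>
    have "ennreal (1 / \<delta>) \<le> V t \<omega>"
      if *: "norm (S t \<omega>) > l * real t / 2 * (v + \<sigma>\<^sup>2 * \<tau>) + (1 / (2 * \<sigma>\<^sup>2) + ln (1 / \<delta>)) / l" for t \<omega>
    proof -
      \<comment> \<open>The unit vector along \<open>S t\<close>, or zero if
        \<open>S t \<omega> = 0\<close>; hence the inequality \<open>norm a \<le> 1\<close>
        below.\<close>
      define a where "a = sgn (S t \<omega>)"
      have a: "norm a \<le> 1" "a \<bullet> (l *\<^sub>R S t \<omega>) = l * norm (S t \<omega>)"
        by (cases "S t \<omega> = 0"; simp add: a_def norm_sgn sgn_div_norm power2_norm_eq_inner[symmetric]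
            power2_eq_square)+
      have "a \<bullet> A t a \<le> real t * l\<^sup>2 / 2 * v"
        using mult_left_mono[OF quad[OF a(1)], of "real t * l\<^sup>2 / 2"] by (simp add: A_def)
      moreover have "\<sigma>\<^sup>2 * (\<Sum>b\<in>Basis. b \<bullet> A t b) \<le> real t * l\<^sup>2 / 2 * (\<sigma>\<^sup>2 * \<tau>)"
      proof -
        have "(\<Sum>b\<in>Basis. b \<bullet> (\<Sigma> *v b)) = trace \<Sigma>"
          by (simp add: Basis_vec_def trace_def sum.UNION_disjoint axis_eq_axis inner_axis' matrix_vector_mul_component
              inner_axis UNION_singleton_eq_range sum.reindex inj_on_def)
        then have "\<sigma>\<^sup>2 * (\<Sum>b\<in>Basis. b \<bullet> A t b) = (real t * l\<^sup>2 / 2 * \<sigma>\<^sup>2) * trace \<Sigma>"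
          unfolding A_def inner_scaleR_right sum_distrib_left[symmetric] by simp
        also have "\<dots> \<le> (real t * l\<^sup>2 / 2 * \<sigma>\<^sup>2) * \<tau>"
          using tr by (intro mult_left_mono) auto
        finally show ?thesis
          by simp
      qed
      moreover have "(norm a)\<^sup>2 / (2 * \<sigma>\<^sup>2) \<le> 1 / (2 * \<sigma>\<^sup>2)"
        using a(1) by (intro divide_right_mono) (auto simp: power_le_one)
      moreover have "real t * l\<^sup>2 / 2 * v + real t * l\<^sup>2 / 2 * (\<sigma>\<^sup>2 * \<tau>) + 1 / (2 * \<sigma>\<^sup>2) + ln (1 / \<delta>) < l * norm (S t \<omega>)"
      proof -
        have eq: "l * (l * real t / 2 * (v + q) + C / l) = real t * l\<^sup>2 / 2 * v + real t * l\<^sup>2 / 2 * q + C" for q C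
          using l by (simp add: distrib_left power2_eq_square) (simp add: mult_ac)
        show ?thesis
          using mult_strict_left_mono[OF * l] unfolding eq by simp
      qed
      ultimately have "ln (1 / \<delta>) \<le> a \<bullet> (l *\<^sub>R S t \<omega>) - (a \<bullet> A t a + \<sigma>\<^sup>2 * (\<Sum>b\<in>Basis. b \<bullet> A t b)) - (norm a)\<^sup>2 / (2 * \<sigma>\<^sup>2)"
        unfolding a(2) by linarith
      then have "1 / \<delta> \<le> exp (a \<bullet> (l *\<^sub>R S t \<omega>) - (a \<bullet> A t a + \<sigma>\<^sup>2 * (\<Sum>b\<in>Basis. b \<bullet> A t b)) - (norm a)\<^sup>2 / (2 * \<sigma>\<^sup>2))"
        using \<delta> by (metis exp_le_cancel_iff exp_ln zero_less_divide_1_iff)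
      from order_trans[OF ennreal_leI[OF this] gauss_mixture_ge[OF \<sigma> A_lin]] show ?thesis
        unfolding V_def W_def .
    qed
    then show "{\<omega> \<in> space M. \<exists>t. norm (S t \<omega>) > l * real t / 2 * (v + \<sigma>\<^sup>2 * \<tau>) + (1 / (2 * \<sigma>\<^sup>2) + ln (1 / \<delta>)) / l}
        \<subseteq> {\<omega> \<in> space M. \<exists>t. ennreal (1 / \<delta>) \<le> V t \<omega>}"
      by blast
  qed
  ultimately show ?thesis
    by simp
qed

end

subsection \<open>Stitching over epochs\<close>

text \<open>The tail telescopes, because
  \<open>1 / k\<^sup>2 \<le> 1 / (k - 1/2) - 1 / (k + 1/2)\<close>. The strengthened bound is an
  equality at \<open>n = 2\<close>, where both sides are 1.25.\<close>

lemma sum_inverse_squares_le: "(\<Sum>j<n. 1 / (real j + 1)\<^sup>2) \<le> 1.65"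
proof -
  have tail: "(\<Sum>j<n. 1 / (real j + 1)\<^sup>2) \<le> 1.65 - 1 / (real n + 1 / 2)" if "n \<ge> 2" for n
    using that
  proof (induction n rule: dec_induct)
    case base
    then show ?case by (simp add: numeral_2_eq_2 power2_eq_square)
  next
    case (step n)
    have "1 / (real n + 1)\<^sup>2 \<le> 1 / (real n + 1 / 2) - 1 / (real (Suc n) + 1 / 2)"
      by (simp add: divide_simps power2_eq_square) (simp add: algebra_simps)
    with step.IH show ?case by simp
  qed
  have "(\<Sum>j<n. 1 / (real j + 1)\<^sup>2) \<le> (\<Sum>j<n + 2. 1 / (real j + 1)\<^sup>2)"
    by (intro sum_mono2) auto
  also have "\<dots> \<le> 1.65"
    using tail[of "n + 2"] by (rule order_trans) simp_all
  finally show ?thesis .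
qed

text \<open>The cost of using at time \<open>t\<close> parameters tuned for time \<open>n\<close>:
  for \<open>A > 0\<close> the ratio to the ideal value is
  \<open>(sqrt (t / n) + sqrt (n / t)) / 2\<close>, which over one doubling is largest at
  \<open>t = 2 * n\<close>, about 1.061.\<close>

lemma epoch_loss:
  fixes A n t :: real
  assumes "0 < n" "n \<le> t" "t \<le> 2 * n" "0 \<le> A"
  shows "(t * sqrt (A / n) + sqrt (A * n)) / 2 \<le> 1.1 * (t * sqrt (A / t))"
proof -
  have "(t + n)\<^sup>2 \<le> 4.84 * (n * t)"
  proof -
    \<comment> \<open>This product rearranges to \<open>(t + n)\<^sup>2 \<le> 4.5 * (n * t)\<close>;
      the rounder 4.84 is \<open>2.2\<^sup>2\<close>.\<close>
    have "(t - n / 2) * (t - 2 * n) \<le> 0"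
      using assms by (intro mult_nonneg_nonpos) auto
    moreover have "0 \<le> n * t"
      using assms by simp
    ultimately show ?thesis
      by (simp add: power2_eq_square algebra_simps)
  qed
  also have "4.84 * (n * t) = (2.2 * (sqrt n * sqrt t))\<^sup>2"
    using assms by (simp add: power_mult_distrib power_divide)
  finally have le: "t + n \<le> 2.2 * (sqrt n * sqrt t)"
    by (rule power2_le_imp_le) (use assms in simp)
  have sq: "sqrt n * sqrt n = n" "sqrt t * sqrt t = t"
    using assms by simp_all
  have "(t * sqrt (A / n) + sqrt (A * n)) / 2 = sqrt A * (t + n) / (2 * sqrt n)"
    using assms sq(1) by (simp add: real_sqrt_mult real_sqrt_divide field_simps)
  also have "\<dots> \<le> sqrt A * (2.2 * (sqrt n * sqrt t)) / (2 * sqrt n)"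
    using assms le by (intro divide_right_mono mult_left_mono) auto
  also have "\<dots> = 1.1 * (t * sqrt (A / t))"
    using assms sq(2) by (simp add: real_sqrt_divide field_simps)
  finally show ?thesis .
qed

text \<open>\<open>l\<close> and \<open>\<sigma>\<close> minimise the bound of
  \<open>uniform_sphere\<close> at \<open>t = n\<close>. Balancing the trace term against
  \<open>1 / (2 * \<sigma>\<^sup>2)\<close> removes \<open>l\<close> from both, so \<open>l\<close>
  is free to balance \<open>v\<close> against \<open>L\<close>.\<close>

lemma epoch_bound:
  fixes t n L L' v \<tau> l \<sigma> :: real
  assumes n: "0 < n" "n \<le> t" "t \<le> 2 * n" and L: "0 < L" "L \<le> L'" and v: "0 < v" and \<tau>: "0 < \<tau>"
    and l: "l = sqrt (2 * L / (n * v))" and \<sigma>: "\<sigma>\<^sup>2 = 1 / (l * sqrt (\<tau> * n))"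
  shows "l * t / 2 * (v + \<sigma>\<^sup>2 * \<tau>) + (1 / (2 * \<sigma>\<^sup>2) + L) / l
    \<le> t * (1.21 * sqrt (\<tau> / t) + 1.682 * sqrt (v * L' / t))"
proof -
  have t: "0 < t" and L': "0 < L'"
    using n L by auto
  have l_pos: "0 < l"
    using n L v by (simp add: l)
  have sq: "sqrt n * sqrt n = n" "sqrt v * sqrt v = v" "sqrt L * sqrt L = L" "sqrt \<tau> * sqrt \<tau> = \<tau>" "sqrt 2 * sqrt 2 = (2::real)"
    using n v L \<tau> by simp_all
  have lv: "l * v = sqrt (2 * L * v / n)"
    using n v L sq by (simp add: l real_sqrt_mult real_sqrt_divide field_simps)
  have Ll: "L / l = sqrt (2 * L * v * n) / 2"
    using n v L sq by (simp add: l real_sqrt_mult real_sqrt_divide field_simps)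
  have t1: "\<tau> / sqrt (\<tau> * n) = sqrt (\<tau> / n)"
    using n \<tau> sq by (simp add: real_sqrt_mult real_sqrt_divide field_simps)
  have "l * t / 2 * (v + \<sigma>\<^sup>2 * \<tau>) + (1 / (2 * \<sigma>\<^sup>2) + L) / l
      = t * (l * v) / 2 + t * (\<tau> / sqrt (\<tau> * n)) / 2 + sqrt (\<tau> * n) / 2 + L / l"
    unfolding \<sigma> using l_pos by (simp add: field_simps)
  \<comment> \<open>Both brackets have the shape of \<open>epoch_loss\<close>, with
    \<open>A = \<tau>\<close> and \<open>A = 2 * L * v\<close>.\<close>
  also have "\<dots> = (t * sqrt (\<tau> / n) + sqrt (\<tau> * n)) / 2
      + (t * sqrt (2 * L * v / n) + sqrt (2 * L * v * n)) / 2"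
    unfolding lv Ll t1 by (simp add: add_divide_distrib)
  also have "\<dots> \<le> 1.1 * (t * sqrt (\<tau> / t)) + 1.1 * (t * sqrt (2 * L * v / t))"
    using n L v \<tau> by (intro add_mono epoch_loss) auto
  \<comment> \<open>The loss 1.1 is below 1.21; with \<open>sqrt 2 \<le> 1.5\<close> it becomes
    1.65, below 1.682.\<close>
  also have "\<dots> \<le> 1.21 * (t * sqrt (\<tau> / t)) + 1.682 * (t * sqrt (v * L' / t))"
  proof (rule add_mono)
    show "1.1 * (t * sqrt (\<tau> / t)) \<le> 1.21 * (t * sqrt (\<tau> / t))"
      using t \<tau> by (intro mult_right_mono) auto
    have "sqrt 2 \<le> 1.5"
      by (rule real_le_lsqrt) (simp_all add: power2_eq_square)
    have "sqrt (2 * L * v / t) \<le> sqrt (2 * (v * L' / t))"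
      using L v t by (intro real_sqrt_le_mono) (simp add: field_simps)
    also have "\<dots> = sqrt 2 * sqrt (v * L' / t)"
      by (rule real_sqrt_mult)
    also have "\<dots> \<le> 1.5 * sqrt (v * L' / t)"
      using \<open>sqrt 2 \<le> 1.5\<close> v L' t by (intro mult_right_mono) auto
    finally have "1.1 * (t * sqrt (2 * L * v / t)) \<le> 1.1 * (t * (1.5 * sqrt (v * L' / t)))"
      using t by (intro mult_left_mono) auto
    also have "\<dots> = 1.65 * (t * sqrt (v * L' / t))"
      by simp
    also have "\<dots> \<le> 1.682 * (t * sqrt (v * L' / t))"
      using t v L' by (intro mult_right_mono) auto
    finally show "1.1 * (t * sqrt (2 * L * v / t)) \<le> 1.682 * (t * sqrt (v * L' / t))" .
  qed
  finally show ?thesis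
    by (simp add: algebra_simps)
qed

text \<open>Every \<open>t \<ge> 1\<close> lies in a dyadic epoch, and a failure at \<open>t\<close>
  is a failure of the uniform bound tuned for that epoch; the union bound over epochs costs at most
  \<alpha>.\<close>

lemma (in sub_gaussian_process) stitched_sphere:
  fixes \<alpha> \<tau> v :: real
  assumes \<alpha>: "0 < \<alpha>" "\<alpha> < 1" and v: "0 < v" and \<tau>: "0 < \<tau>"
    and quad: "\<And>x. norm x \<le> 1 \<Longrightarrow> x \<bullet> (\<Sigma> *v x) \<le> v" and tr: "trace \<Sigma> \<le> \<tau>"
  shows "1 - \<alpha> \<le> prob {\<omega> \<in> space M. \<forall>t\<ge>1. norm (S t \<omega>) \<le>
    real t * (1.21 * sqrt (\<tau> / real t) + 1.682 * sqrt (v * (ln (1.65 / \<alpha>) + 2 * ln (log 2 (real t) + 1)) / real t))}"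
    (is "_ \<le> prob ?G")
proof -
  \<comment> \<open>Weights \<open>1 / (real j + 1)\<^sup>2\<close>, normalised through
    \<open>sum_inverse_squares_le\<close>; \<open>ln (1 / \<delta> j)\<close> then has the shape of
    the logarithmic term in the goal.\<close>
  define \<delta> where "\<delta> j = \<alpha> / 1.65 * (1 / (real j + 1)\<^sup>2)" for j :: nat
  define L where "L j = ln (1 / \<delta> j)" for j
  define l where "l j = sqrt (2 * L j / (2 ^ j * v))" for j
  define \<sigma> where "\<sigma> j = sqrt (1 / (l j * sqrt (\<tau> * 2 ^ j)))" for j
  define N where "N j = {\<omega> \<in> space M. \<exists>t. norm (S t \<omega>) >
    l j * real t / 2 * (v + (\<sigma> j)\<^sup>2 * \<tau>) + (1 / (2 * (\<sigma> j)\<^sup>2) + L j) / l j}" for j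
  have \<delta>: "0 < \<delta> j" for j
    using \<alpha> by (simp add: \<delta>_def add_pos_pos)
  have L_eq: "L j = ln (1.65 / \<alpha>) + 2 * ln (real j + 1)" for j
  proof -
    have "1 / \<delta> j = 1.65 / \<alpha> * (real j + 1)\<^sup>2"
      by (simp add: \<delta>_def)
    then have "L j = ln (1.65 / \<alpha> * (real j + 1)\<^sup>2)"
      unfolding L_def by (rule arg_cong)
    also have "\<dots> = ln (1.65 / \<alpha>) + ln ((real j + 1)\<^sup>2)"
      using \<alpha> by (intro ln_mult_pos) (auto simp: add_pos_pos)
    also have "ln ((real j + 1)\<^sup>2) = 2 * ln (real j + 1)"
      by (simp add: ln_realpow)
    finally show ?thesis .
  qed
  \<comment> \<open>This follows from \<open>\<alpha> < 1\<close> and makes \<open>L j\<close>,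
    hence \<open>l j\<close>, positive already at \<open>j = 0\<close>.\<close>
  have ln0: "0 < ln (1.65 / \<alpha>)"
    using \<alpha> by (intro ln_gt_zero) (simp add: field_simps)
  have L_pos: "0 < L j" for j
    unfolding L_eq using ln0 by (intro add_pos_nonneg) auto
  have l_pos: "0 < l j" for j
    using L_pos[of j] v by (simp add: l_def)
  have \<sigma>_pos: "0 < \<sigma> j" for j
    using l_pos[of j] \<tau> by (simp add: \<sigma>_def)
  have \<sigma>_sq: "(\<sigma> j)\<^sup>2 = 1 / (l j * sqrt (\<tau> * 2 ^ j))" for j
    using l_pos[of j] \<tau> by (simp add: \<sigma>_def)
  have N_sets [measurable]: "N j \<in> events" for j
    unfolding N_def by measurable
  have N_le: "prob (N j) \<le> \<delta> j" for j
    unfolding N_def L_def using l_pos \<sigma>_pos \<delta> v quad tr by (intro uniform_sphere) auto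
  have G_sets [measurable]: "?G \<in> events"
    by measurable
  have sum_le: "(\<Sum>j<n. prob (N j)) \<le> \<alpha>" for n
  proof -
    have "(\<Sum>j<n. prob (N j)) \<le> (\<Sum>j<n. \<delta> j)"
      by (intro sum_mono N_le)
    also have "\<dots> = \<alpha> / 1.65 * (\<Sum>j<n. 1 / (real j + 1)\<^sup>2)"
      unfolding \<delta>_def by (rule sum_distrib_left[symmetric])
    also have "\<dots> \<le> \<alpha> / 1.65 * 1.65"
      using \<alpha> by (intro mult_left_mono sum_inverse_squares_le) auto
    finally show ?thesis
      by simp
  qed
  then have summable: "summable (\<lambda>j. prob (N j))"
    by (intro summableI_nonneg_bounded) auto
  have "space M - ?G \<subseteq> (\<Union>j. N j)"
  proof
    fix \<omega> assume "\<omega> \<in> space M - ?G"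
    then obtain t :: nat where \<omega>: "\<omega> \<in> space M" and t: "1 \<le> t" and
      bad: "norm (S t \<omega>) > real t * (1.21 * sqrt (\<tau> / real t)
        + 1.682 * sqrt (v * (ln (1.65 / \<alpha>) + 2 * ln (log 2 (real t) + 1)) / real t))"
      by (auto simp: not_le)
    obtain j where j: "2 ^ j \<le> t" "t < 2 ^ (j + 1)"
      using ex_power_ivl1[of 2 t] t by auto
    have jt: "2 ^ j \<le> real t" "real t \<le> 2 * 2 ^ j"
      using of_nat_mono[OF j(1), where 'a=real] of_nat_mono[OF less_imp_le[OF j(2)], where 'a=real] by simp_all
    \<comment> \<open>Bounding the epoch index by \<open>log 2 t\<close> is how the iterated
      logarithm enters.\<close>
    have "real j \<le> log 2 (real t)"
      using jt(1) t by (intro le_log_of_power) auto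
    then have "L j \<le> ln (1.65 / \<alpha>) + 2 * ln (log 2 (real t) + 1)"
      unfolding L_eq by (intro add_left_mono mult_left_mono ln_mono) auto
    then have "l j * real t / 2 * (v + (\<sigma> j)\<^sup>2 * \<tau>) + (1 / (2 * (\<sigma> j)\<^sup>2) + L j) / l j
        \<le> real t * (1.21 * sqrt (\<tau> / real t)
          + 1.682 * sqrt (v * (ln (1.65 / \<alpha>) + 2 * ln (log 2 (real t) + 1)) / real t))"
      using jt L_pos[of j] v \<tau> l_def \<sigma>_sq by (intro epoch_bound[where n="2 ^ j"]) auto
    from order.strict_trans1[OF this bad] \<omega> show "\<omega> \<in> (\<Union>j. N j)"
      unfolding N_def by blast
  qed
  then have "prob (space M - ?G) \<le> prob (\<Union>j. N j)"
    by (intro finite_measure_mono) auto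
  also have "\<dots> \<le> (\<Sum>j. prob (N j))"
    using summable by (intro finite_measure_subadditive_countably) auto
  also have "\<dots> \<le> \<alpha>"
    using summable sum_le by (rule suminf_le_const)
  finally show ?thesis
    using prob_compl[OF G_sets] by simp
qed

section \<open>From positive upper bounds to the norm and trace themselves\<close>

theorem theorem2p3:
  fixes M :: "'a measure"
    and X :: "nat \<Rightarrow> 'a \<Rightarrow> real ^ 'n"
    and \<mu> :: "real ^ 'n"
    and \<Sigma> :: "real ^ 'n ^ 'n"
    and \<alpha> :: real
  assumes "prob_space M"
    and "pos_semidef \<Sigma>"
    and "\<And>t. t \<ge> 1 \<Longrightarrow> X t \<in> borel_measurable M"
    and "\<And>t. t \<ge> 1 \<Longrightarrow> integrable M (X t)"
    and "\<And>t. t \<ge> 1 \<Longrightarrow> AE \<omega> in M. vec_cond_exp M (nat_filtration M X (t - 1)) (X t) \<omega> = \<mu>"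
    and "cond_sub_gaussian M X \<mu> \<Sigma>"
    and "0 < \<alpha>" and "\<alpha> < 1"
  shows "measure M {\<omega> \<in> space M. \<forall>t\<ge>1.
      norm ((1 / real t) *\<^sub>R (\<Sum>i=1..t. X i \<omega>) - \<mu>)
        \<le> 1.21 * sqrt (trace \<Sigma> / real t)
          + 1.682 * sqrt (onorm (\<lambda>x. \<Sigma> *v x)
              * (ln (1.65 / \<alpha>) + 2 * ln (log 2 (real t) + 1)) / real t)} \<ge> 1 - \<alpha>"
proof -
  interpret sub_gaussian_process M X \<mu> \<Sigma>
    using assms by (simp add: sub_gaussian_process_def sub_gaussian_process_axioms_def)
  define v where "v = onorm (\<lambda>x. \<Sigma> *v x)"
  define \<Lambda> where "\<Lambda> t = ln (1.65 / \<alpha>) + 2 * ln (log 2 (real t) + 1)" for t :: nat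
  \<comment> \<open>\<open>e\<close> enlarges norm and trace, since both vanish for
    \<open>\<Sigma> = 0\<close> while \<open>stitched_sphere\<close> asks for positive
    bounds.\<close>
  define R where "R e t = 1.21 * sqrt ((trace \<Sigma> + e) / real t) + 1.682 * sqrt ((v + e) * \<Lambda> t / real t)"
    for e and t :: nat
  define \<epsilon> where "\<epsilon> m = inverse (real (Suc m))" for m
  define G where "G m = {\<omega> \<in> space M. \<forall>t\<ge>1. norm (S t \<omega>) \<le> real t * R (\<epsilon> m) t}" for m
  have bl: "bounded_linear (\<lambda>x. \<Sigma> *v x)"
    by (rule matrix_vector_mul_bounded_linear)
  have v0: "0 \<le> v"
    unfolding v_def by (rule onorm_pos_le[OF bl])
  have quad: "x \<bullet> (\<Sigma> *v x) \<le> v" if "norm x \<le> 1" for x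
  proof -
    have "x \<bullet> (\<Sigma> *v x) \<le> norm x * norm (\<Sigma> *v x)"
      by (rule norm_cauchy_schwarz)
    also have "\<dots> \<le> 1 * (v * norm x)"
      unfolding v_def using that by (intro mult_mono onorm[OF bl]) auto
    also have "\<dots> \<le> v"
      using that v0 by (simp add: mult_left_le)
    finally show ?thesis .
  qed
  have tr0: "0 \<le> trace \<Sigma>"
    unfolding trace_def
  proof (rule sum_nonneg)
    fix i
    \<comment> \<open>A diagonal entry is the quadratic form at a coordinate vector.\<close>
    have "0 \<le> axis i 1 \<bullet> (\<Sigma> *v axis i 1)"
      using assms(2) by (simp add: pos_semidef_def)
    then show "0 \<le> \<Sigma> $ i $ i"
      by (simp add: inner_axis' matrix_vector_mul_component inner_axis)
  qed
  have \<Lambda>0: "0 \<le> \<Lambda> t" if "t \<ge> 1" for t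
    unfolding \<Lambda>_def using assms(7,8) that
    by (intro add_nonneg_nonneg mult_nonneg_nonneg ln_ge_zero) (auto simp: field_simps)
  have \<epsilon>0: "0 < \<epsilon> m" for m
    by (simp add: \<epsilon>_def)
  have G_sets: "G m \<in> events" for m
    unfolding G_def by measurable
  have G_ge: "1 - \<alpha> \<le> prob (G m)" for m
    unfolding G_def R_def \<Lambda>_def using assms(7,8) \<epsilon>0[of m] v0 tr0
    by (intro stitched_sphere) (auto intro: order_trans[OF quad])
  \<comment> \<open>As \<open>\<Lambda> t\<close> is nonnegative, \<open>R\<close> grows with
    \<open>e\<close>; so \<open>G\<close> decreases, and continuity from above preserves the
    probability bound in the intersection.\<close>
  have "decseq G"
  proof (rule decseq_SucI)
    fix m
    have "R (\<epsilon> (Suc m)) t \<le> R (\<epsilon> m) t" if "t \<ge> 1" for t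
      unfolding R_def using \<Lambda>0[OF that]
      by (intro add_mono mult_left_mono real_sqrt_le_mono divide_right_mono mult_right_mono)
        (auto simp: \<epsilon>_def field_simps)
    then have "real t * R (\<epsilon> (Suc m)) t \<le> real t * R (\<epsilon> m) t" if "t \<ge> 1" for t
      using that by (intro mult_left_mono) auto
    then show "G (Suc m) \<subseteq> G m"
      unfolding G_def by (blast intro: order_trans)
  qed
  then have "(\<lambda>m. prob (G m)) \<longlonglongrightarrow> prob (\<Inter>m. G m)"
    using G_sets by (intro finite_Lim_measure_decseq) auto
  then have "1 - \<alpha> \<le> prob (\<Inter>m. G m)"
    by (rule LIMSEQ_le_const) (use G_ge in blast)
  also have "\<dots> \<le> prob {\<omega> \<in> space M. \<forall>t\<ge>1. norm (S t \<omega>) \<le> real t * R 0 t}"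
  proof (intro finite_measure_mono)
    \<comment> \<open>For fixed \<open>t\<close> the bound holds at every
      \<open>\<epsilon> m\<close>, and \<open>R\<close> is continuous in \<open>e\<close>.\<close>
    have "norm (S t \<omega>) \<le> real t * R 0 t" if "\<omega> \<in> (\<Inter>m. G m)" "t \<ge> 1" for \<omega> t
    proof (rule LIMSEQ_le_const)
      have "\<epsilon> \<longlonglongrightarrow> 0"
        unfolding \<epsilon>_def[abs_def] by (rule LIMSEQ_inverse_real_of_nat)
      then show "(\<lambda>m. real t * R (\<epsilon> m) t) \<longlonglongrightarrow> real t * R 0 t"
        unfolding R_def using that(2) by (intro tendsto_intros) auto
      show "\<exists>N. \<forall>m\<ge>N. norm (S t \<omega>) \<le> real t * R (\<epsilon> m) t"
        using that by (auto simp: G_def)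
    qed
    then show "(\<Inter>m. G m) \<subseteq> {\<omega> \<in> space M. \<forall>t\<ge>1. norm (S t \<omega>) \<le> real t * R 0 t}"
      by (auto simp: G_def)
    show "{\<omega> \<in> space M. \<forall>t\<ge>1. norm (S t \<omega>) \<le> real t * R 0 t} \<in> events"
      by measurable
  qed
  also have "{\<omega> \<in> space M. \<forall>t\<ge>1. norm (S t \<omega>) \<le> real t * R 0 t}
      = {\<omega> \<in> space M. \<forall>t\<ge>1. norm ((1 / real t) *\<^sub>R (\<Sum>i=1..t. X i \<omega>) - \<mu>) \<le> R 0 t}"
  proof -
    have "norm (S t \<omega>) \<le> real t * R 0 t \<longleftrightarrow>
        norm ((1 / real t) *\<^sub>R (\<Sum>i=1..t. X i \<omega>) - \<mu>) \<le> R 0 t" if "t \<ge> 1" for t \<omega>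
    proof -
      have "S t \<omega> = real t *\<^sub>R ((1 / real t) *\<^sub>R (\<Sum>i=1..t. X i \<omega>) - \<mu>)"
        using that by (simp add: S_def sum_subtractf scaleR_right_diff_distrib sum_constant_scaleR
            del: sum_constant)
      then have "norm (S t \<omega>) = real t * norm ((1 / real t) *\<^sub>R (\<Sum>i=1..t. X i \<omega>) - \<mu>)"
        by simp
      then show ?thesis
        using that by simp
    qed
    then show ?thesis
      by blast
  qed
  finally show ?thesis
    unfolding R_def \<Lambda>_def v_def by simp
qed

end
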